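(* Let $H$ be a fixed finite simple graph with at least one edge, and let $\Delta:=\max_{H'\subseteq H}\frac{e_{H'}}{v_{H'}}$, the maximum being over (nonempty) subgraphs $H'$ of $H$. Let the edges of $K_n$ carry i.i.d. $\mathrm{Exp}(1)$ weights. Then for any fixed $\alpha\in[0,1)$, $$C_H(\alpha n,n)=\Omega_{\mathbb{P}}\big(n^{1-1/\max\{d_H,\Delta\}}\big)\quad\text{as } n\to\infty.$$
   Context: For a graph $G$, $v_G$ and $e_G$ denote its numbers of vertices and edges, and $d_G:=e_G/(v_G-1)$ for $v_G\ge2$. An $(\alpha,H)$-cover on $K_n$ is a collection $Q$ of (not necessarily induced, not necessarily disjoint) subgraphs of $K_n$, each isomorphic to $H$, such that at most $\alpha n$ vertices of $K_n$ are not covered by any $H'\in Q$. Given edge weights $(X_e)$, its weight is $W_Q:=\sum_{H'\in Q}\sum_{e\in\mathcal{E}(H')}X_e$, where $\mathcal{E}(H')$ is the edge set of $H'$ (an edge lying in several copies $H'\in Q$ is counted once for each such copy). Define $C_H(k,n):=\min\{W_Q: Q\text{ is a }(k/n,H)\text{-cover on }K_n\}$. For random variables $X_n,Y_n$ (possibly deterministic), $Y_n=\Omega_{\mathbb{P}}(X_n)$ means: for every $\varepsilon>0$ there is $C=C(\varepsilon)$ such that $\mathbb{P}(|X_n|>C|Y_n|)<\varepsilon$ for all sufficiently large $n$. *)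

theory Defs
  imports "HOL-Probability.Probability"
begin

text \<open>A graph is a pair of a vertex set and a set of edges, each edge being the two-element set of
  its endpoints. Isolated vertices are allowed.\<close>

record 'a graph =
  verts :: "'a set"
  edges :: "'a set set"

definition pairs :: "'a set \<Rightarrow> 'a set set" where
  "pairs V = {{u, v} | u v. u \<in> V \<and> v \<in> V \<and> u \<noteq> v}"

definition finite_simple_graph :: "'a graph \<Rightarrow> bool" where
  "finite_simple_graph G \<longleftrightarrow> finite (verts G) \<and> edges G \<subseteq> pairs (verts G)"

definition complete_graph :: "nat \<Rightarrow> nat graph" where
  "complete_graph n = \<lparr>verts = {..<n}, edges = pairs {..<n}\<rparr>"

definition subgraph :: "'a graph \<Rightarrow> 'a graph \<Rightarrow> bool" where
  "subgraph H G \<longleftrightarrow> verts H \<subseteq> verts G \<and> edges H \<subseteq> edges G \<and> edges H \<subseteq> pairs (verts H)"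

definition isomorphic :: "'a graph \<Rightarrow> 'b graph \<Rightarrow> bool" where
  "isomorphic G H \<longleftrightarrow> (\<exists>f. bij_betw f (verts G) (verts H) \<and> edges H = (\<lambda>e. f ` e) ` edges G)"

definition num_verts :: "'a graph \<Rightarrow> nat" where
  "num_verts G = card (verts G)"

definition num_edges :: "'a graph \<Rightarrow> nat" where
  "num_edges G = card (edges G)"

definition dens :: "'a graph \<Rightarrow> real" where
  "dens G = real (num_edges G) / (real (num_verts G) - 1)"

definition max_dens :: "'a graph \<Rightarrow> real" where
  "max_dens H =
     Max {real (num_edges H') / real (num_verts H') | H'. subgraph H' H \<and> verts H' \<noteq> {}}"

definition is_cover :: "real \<Rightarrow> 'a graph \<Rightarrow> nat \<Rightarrow> nat graph set \<Rightarrow> bool" where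
  "is_cover \<alpha> H n Q \<longleftrightarrow>
     (\<forall>H'\<in>Q. subgraph H' (complete_graph n) \<and> isomorphic H' H) \<and>
     real (card (verts (complete_graph n) - (\<Union>H'\<in>Q. verts H'))) \<le> \<alpha> * real n"

definition cover_weight :: "(nat set \<Rightarrow> real) \<Rightarrow> nat graph set \<Rightarrow> real" where
  "cover_weight X Q = (\<Sum>H'\<in>Q. \<Sum>e\<in>edges H'. X e)"

text \<open>The minimum ranges over a finite set, which for finite \<open>H\<close> and \<open>k \<ge> 0\<close> is nonempty as soon as
  \<open>n \<ge> num_verts H\<close>. For smaller \<open>n\<close> there may be no cover, and the value is then unspecified.\<close>

definition min_cover_weight :: "'a graph \<Rightarrow> (nat set \<Rightarrow> real) \<Rightarrow> real \<Rightarrow> nat \<Rightarrow> real" where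
  "min_cover_weight H X k n = Min {cover_weight X Q | Q. is_cover (k / real n) H n Q}"

text \<open>\<open>Omega_P M Y X\<close> is $Y_n = \Omega_{\mathbb{P}}(X_n)$; the variables with index \<open>n\<close> live on the
  probability space \<open>M n\<close>.\<close>

definition Omega_P :: "(nat \<Rightarrow> 'w measure) \<Rightarrow> (nat \<Rightarrow> 'w \<Rightarrow> real) \<Rightarrow> (nat \<Rightarrow> 'w \<Rightarrow> real) \<Rightarrow> bool" where
  "Omega_P M Y X \<longleftrightarrow>
     (\<forall>\<epsilon>>0. \<exists>C::real. eventually
        (\<lambda>n. measure (M n) {\<omega> \<in> space (M n). \<bar>X n \<omega>\<bar> > C * \<bar>Y n \<omega>\<bar>} < \<epsilon>) sequentially)"

end

theory Submission
  imports Defs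
begin

text \<open>
  Call a copy of a graph light if each of its edges has weight at most \<open>t\<close>. A cover of all but
  \<open>\<alpha> n\<close> vertices consists of at least \<open>(1 - \<alpha>) n / v\<close> copies of \<open>H\<close>, where \<open>v\<close> is the number of
  vertices of \<open>H\<close>. A copy that is not light weighs more than \<open>t\<close>, so a cover is expensive unless a
  positive proportion of its copies is light; if there are at most \<open>\<kappa> n\<close> light copies in the whole
  of \<open>K\<^sub>n\<close>, with \<open>\<kappa> = (1 - \<alpha>) / (2 v)\<close>, then every cover weighs at least \<open>\<kappa> n t\<close>
  (\<open>cover_weight_lower_bound\<close>). This uses that an edge is paid for once for each copy containing it.

  An edge is light with probability \<open>1 - exp (- t) \<le> t\<close>, so the expected number of light copies of a
  graph \<open>G\<close> is at most \<open>n ^ v\<^sub>G * t ^ e\<^sub>G\<close>, and Markov's inequality applies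
  (\<open>prob_many_light_embeddings\<close>). Take \<open>t = c * n powr (- 1 / D)\<close> with \<open>D\<close> the maximum in the
  exponent, so that \<open>\<kappa> n t\<close> has the required order. There are two ways to see that few copies of \<open>H\<close> are
  light (\<open>prob_many_light_H\<close>):
  if \<open>D = d\<^sub>H\<close>, the expected number of light copies of \<open>H\<close> is at most \<open>c n\<close>;
  if \<open>D = \<Delta>\<close> is the density of \<open>G \<subseteq> H\<close>, the expected number of light copies of \<open>G\<close> is at most
  \<open>c\<close>, so with probability at least \<open>1 - c\<close> the graph \<open>G\<close>, and therefore \<open>H\<close>, has no light copy at all.
\<close>

section \<open>Embeddings of a graph into the complete graph\<close>

text \<open>Copies are counted through the embeddings that parametrise them. This overcounts by a constant
  factor only, and it makes the factor \<open>n ^ v\<^sub>G\<close> of the first moment evident. The maps are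
  extensional so that there are finitely many of them.\<close>

definition embeddings :: "'a graph \<Rightarrow> nat \<Rightarrow> ('a \<Rightarrow> nat) set" where
  "embeddings G n = {f \<in> verts G \<rightarrow>\<^sub>E {..<n}. inj_on f (verts G)}"

definition light_embeddings :: "(nat set \<Rightarrow> real) \<Rightarrow> 'a graph \<Rightarrow> nat \<Rightarrow> real \<Rightarrow> ('a \<Rightarrow> nat) set" where
  "light_embeddings x G n t = {f \<in> embeddings G n. \<forall>e\<in>edges G. x (f ` e) \<le> t}"

definition image_graph :: "('a \<Rightarrow> 'b) \<Rightarrow> 'a graph \<Rightarrow> 'b graph" where
  "image_graph f G = \<lparr>verts = f ` verts G, edges = (\<lambda>e. f ` e) ` edges G\<rparr>"

lemma pairs_subset_Pow: "pairs V \<subseteq> Pow V"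
  by (auto simp: pairs_def)

lemma finite_pairs: "finite V \<Longrightarrow> finite (pairs V)"
  by (rule finite_subset[OF pairs_subset_Pow]) simp

lemma edges_complete_graph: "edges (complete_graph n) = pairs {..<n}"
  and verts_complete_graph: "verts (complete_graph n) = {..<n}"
  by (simp_all add: complete_graph_def)

lemma image_in_pairs: "inj_on f V \<Longrightarrow> e \<in> pairs V \<Longrightarrow> f ` e \<in> pairs (f ` V)"
  unfolding pairs_def by (auto simp: inj_on_def)

lemma finite_edges: "finite_simple_graph G \<Longrightarrow> finite (edges G)"
  unfolding finite_simple_graph_def using finite_pairs finite_subset by blast

lemma finite_embeddings: "finite (verts G) \<Longrightarrow> finite (embeddings G n)"
  by (rule finite_subset[of _ "verts G \<rightarrow>\<^sub>E {..<n}"]) (auto simp: embeddings_def intro: finite_PiE)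

lemma finite_light_embeddings: "finite (verts G) \<Longrightarrow> finite (light_embeddings x G n t)"
  unfolding light_embeddings_def by (simp add: finite_embeddings)

lemma card_embeddings_le:
  assumes "finite (verts G)"
  shows "card (embeddings G n) \<le> n ^ num_verts G"
proof -
  have "card (embeddings G n) \<le> card (verts G \<rightarrow>\<^sub>E {..<n})"
    using assms by (intro card_mono finite_PiE) (auto simp: embeddings_def)
  then show ?thesis
    using assms by (simp add: card_PiE num_verts_def)
qed

lemma embedding_edges:
  assumes "finite_simple_graph G" "f \<in> embeddings G n"
  shows "(\<lambda>e. f ` e) ` edges G \<subseteq> edges (complete_graph n)"
    and "card ((\<lambda>e. f ` e) ` edges G) = num_edges G"
proof -
  have f: "f ` verts G \<subseteq> {..<n}" "inj_on f (verts G)" and E: "edges G \<subseteq> pairs (verts G)"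
    using assms by (auto simp: embeddings_def finite_simple_graph_def)
  show "(\<lambda>e. f ` e) ` edges G \<subseteq> edges (complete_graph n)"
  proof (rule image_subsetI)
    fix e assume "e \<in> edges G"
    then have "f ` e \<in> pairs (f ` verts G)"
      using image_in_pairs f(2) E by blast
    also have "\<dots> \<subseteq> pairs {..<n}"
      using f(1) unfolding pairs_def by blast
    finally show "f ` e \<in> edges (complete_graph n)"
      by (simp add: edges_complete_graph)
  qed
  have "inj_on ((`) f) (edges G)"
    using inj_on_image_Pow[OF f(2)] E pairs_subset_Pow by (metis inj_on_subset)
  then show "card ((\<lambda>e. f ` e) ` edges G) = num_edges G"
    by (simp add: card_image num_edges_def)
qed

lemma copy_is_image_graph:
  assumes "subgraph H' (complete_graph n)" "isomorphic H' H"
  obtains f where "f \<in> embeddings H n" "H' = image_graph f H"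
proof -
  obtain h where h: "bij_betw h (verts H') (verts H)" "edges H = (\<lambda>e. h ` e) ` edges H'"
    using assms(2) by (auto simp: isomorphic_def)
  have V: "verts H' \<subseteq> {..<n}" and E: "edges H' \<subseteq> pairs (verts H')"
    using assms(1) by (auto simp: subgraph_def verts_complete_graph)
  define f where "f = restrict (inv_into (verts H') h) (verts H)"
  have bij: "bij_betw f (verts H) (verts H')"
    using bij_betw_inv_into[OF h(1)] by (simp add: f_def bij_betw_restrict_eq)
  have fh: "f (h x) = x" if "x \<in> verts H'" for x
    using that h(1) by (auto simp: f_def bij_betw_def)
  have "f ` h ` e = e" if "e \<in> edges H'" for e
  proof -
    have "e \<subseteq> verts H'"
      using that E pairs_subset_Pow by blast
    then have "(\<lambda>x. f (h x)) ` e = (\<lambda>x. x) ` e"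
      by (intro image_cong) (auto simp: fh)
    then show ?thesis by (simp add: image_image)
  qed
  then have "(\<lambda>e. f ` e) ` edges H = (\<lambda>e. e) ` edges H'"
    unfolding h(2) image_image[of "\<lambda>e. f ` e"] by (intro image_cong) auto
  then have "H' = image_graph f H"
    using bij by (simp add: image_graph_def bij_betw_def)
  moreover have "f \<in> embeddings H n"
    using bij V by (auto simp: embeddings_def bij_betw_def f_def)
  ultimately show thesis by (rule that[rotated])
qed

lemma image_graph_is_copy:
  assumes "finite_simple_graph H" "f \<in> embeddings H n"
  shows "subgraph (image_graph f H) (complete_graph n)" "isomorphic (image_graph f H) H"
proof -
  have f: "f ` verts H \<subseteq> {..<n}" "inj_on f (verts H)" and E: "edges H \<subseteq> pairs (verts H)"
    using assms by (auto simp: embeddings_def finite_simple_graph_def)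
  show "subgraph (image_graph f H) (complete_graph n)"
    using embedding_edges(1)[OF assms] f E image_in_pairs[OF f(2)]
    by (auto simp: subgraph_def image_graph_def verts_complete_graph)
  define h where "h = inv_into (verts H) f"
  have hf: "h ` f ` e = e" if "e \<in> edges H" for e
  proof -
    have "e \<subseteq> verts H"
      using that E pairs_subset_Pow by blast
    then show ?thesis
      using f(2) unfolding h_def by (simp add: inv_into_image_cancel)
  qed
  have "bij_betw h (f ` verts H) (verts H)"
    unfolding h_def using f(2) by (simp add: bij_betw_inv_into inj_on_imp_bij_betw)
  moreover have "edges H = (\<lambda>e. h ` e) ` (\<lambda>e. f ` e) ` edges H"
    using hf by (simp add: image_image cong: image_cong)
  ultimately show "isomorphic (image_graph f H) H"
    unfolding isomorphic_def image_graph_def by auto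
qed

section \<open>Covers\<close>

lemma cover_subset_images: "is_cover \<alpha> H n Q \<Longrightarrow> Q \<subseteq> (\<lambda>f. image_graph f H) ` embeddings H n"
proof
  fix H' assume "is_cover \<alpha> H n Q" "H' \<in> Q"
  then have "subgraph H' (complete_graph n)" "isomorphic H' H"
    by (simp_all add: is_cover_def)
  then obtain f where "f \<in> embeddings H n" "H' = image_graph f H"
    by (rule copy_is_image_graph)
  then show "H' \<in> (\<lambda>f. image_graph f H) ` embeddings H n"
    by simp
qed

text \<open>The copies of \<open>H\<close> through a vertex are obtained from the sets of \<open>num_verts H\<close> vertices that
  contain it, so the collection of all copies leaves no vertex uncovered.\<close>

lemma all_copies_cover:
  assumes "finite_simple_graph H" "verts H \<noteq> {}" "num_verts H \<le> n" "0 \<le> \<alpha>"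
  shows "is_cover \<alpha> H n ((\<lambda>f. image_graph f H) ` embeddings H n)"
proof -
  have fin: "finite (verts H)"
    using assms(1) by (simp add: finite_simple_graph_def)
  have "\<exists>f\<in>embeddings H n. x \<in> f ` verts H" if "x < n" for x
  proof -
    have "card {x} \<le> num_verts H"
      using assms(2) fin by (simp add: num_verts_def Suc_le_eq card_gt_0_iff)
    then obtain T where T: "{x} \<subseteq> T" "T \<subseteq> {..<n}" "card T = num_verts H"
      using exists_subset_between[of "{x}" "num_verts H" "{..<n}"] assms(3) \<open>x < n\<close> by fastforce
    then obtain g where g: "bij_betw g (verts H) T"
      using finite_same_card_bij[OF fin, of T] finite_subset[of T "{..<n}"]
      by (auto simp: num_verts_def)
    then have "bij_betw (restrict g (verts H)) (verts H) T"
      by (simp add: bij_betw_restrict_eq)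
    with T show ?thesis
      by (intro bexI[of _ "restrict g (verts H)"]) (auto simp: embeddings_def bij_betw_def)
  qed
  then have "verts (complete_graph n) -
      (\<Union>H'\<in>(\<lambda>f. image_graph f H) ` embeddings H n. verts H') = {}"
    by (auto simp: verts_complete_graph image_graph_def)
  moreover have "0 \<le> \<alpha> * real n"
    using assms(4) by simp
  ultimately show ?thesis
    unfolding is_cover_def using image_graph_is_copy[OF assms(1)]
    by (metis (no_types, lifting) card.empty imageE of_nat_0)
qed

lemma min_cover_weight_attained:
  assumes "finite_simple_graph H" "verts H \<noteq> {}" "num_verts H \<le> n" "0 \<le> k"
  obtains Q where "is_cover (k / real n) H n Q" "min_cover_weight H x k n = cover_weight x Q"
proof -
  let ?W = "{cover_weight x Q | Q. is_cover (k / real n) H n Q}"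
  have "finite (verts H)"
    using assms(1) by (simp add: finite_simple_graph_def)
  then have "finite (Pow ((\<lambda>f. image_graph f H) ` embeddings H n))"
    by (simp add: finite_embeddings)
  moreover have "?W \<subseteq> cover_weight x ` Pow ((\<lambda>f. image_graph f H) ` embeddings H n)"
    using cover_subset_images by blast
  ultimately have "finite ?W"
    using finite_surj by blast
  moreover have "?W \<noteq> {}"
    using all_copies_cover[OF assms(1-3), of "k / real n"] assms(4) by auto
  ultimately have "Min ?W \<in> ?W"
    by (rule Min_in)
  then show thesis
    using that unfolding min_cover_weight_def by auto
qed

lemma card_cover_ge:
  assumes "is_cover \<alpha> H n Q" "finite Q"
  shows "(1 - \<alpha>) * real n \<le> real (num_verts H) * real (card Q)"
proof -
  let ?U = "\<Union>H'\<in>Q. verts H'"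
  have sub: "verts H' \<subseteq> {..<n}" "card (verts H') = num_verts H" if "H' \<in> Q" for H'
    using assms(1) that
    by (auto simp: is_cover_def subgraph_def isomorphic_def verts_complete_graph num_verts_def
        bij_betw_same_card)
  have "card ?U \<le> (\<Sum>H'\<in>Q. card (verts H'))"
    using assms(2) by (rule card_UN_le)
  also have "\<dots> = num_verts H * card Q"
    using sub(2) by simp
  finally have U: "real (card ?U) \<le> real (num_verts H) * real (card Q)"
    by (metis of_nat_le_iff of_nat_mult)
  have "card ({..<n} - ?U) = n - card ?U"
    using sub(1) by (subst card_Diff_subset) (auto intro: finite_subset[of _ "{..<n}"])
  then have "real n \<le> real (card ({..<n} - ?U)) + real (card ?U)"
    by linarith
  also have "real (card ({..<n} - ?U)) \<le> \<alpha> * real n"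
    using assms(1) by (simp add: is_cover_def verts_complete_graph)
  finally show ?thesis
    using U by (simp add: algebra_simps)
qed

text \<open>A copy that weighs at most \<open>t\<close> is the image of a light embedding, since no edge weighs more
  than the copy containing it. So all but \<open>K\<close> of the copies in the cover weigh more than \<open>t\<close>.\<close>

lemma cover_weight_lower_bound:
  assumes H: "finite_simple_graph H" "verts H \<noteq> {}"
    and x: "\<And>e. e \<in> edges (complete_graph n) \<Longrightarrow> 0 \<le> x e"
    and Q: "is_cover \<alpha> H n Q"
    and K: "real (card (light_embeddings x H n t)) \<le> K"
    and t: "0 \<le> t"
  shows "((1 - \<alpha>) * real n / real (num_verts H) - K) * t \<le> cover_weight x Q"
proof -
  let ?w = "\<lambda>H'. \<Sum>e\<in>edges H'. x e"
  define L where "L = {H' \<in> Q. ?w H' \<le> t}"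
  have fin: "finite (verts H)"
    using H(1) by (simp add: finite_simple_graph_def)
  have finQ: "finite Q"
    using cover_subset_images[OF Q] finite_embeddings[OF fin] finite_surj by blast
  have edges_Q: "edges H' \<subseteq> edges (complete_graph n)" if "H' \<in> Q" for H'
    using Q that by (auto simp: is_cover_def subgraph_def)
  have fin_edges: "finite (edges H')" if "H' \<in> Q" for H'
    using edges_Q[OF that] finite_pairs[of "{..<n}"] finite_subset
    by (metis edges_complete_graph finite_lessThan)
  have w_nonneg: "0 \<le> ?w H'" if "H' \<in> Q" for H'
    using edges_Q[OF that] x by (intro sum_nonneg) blast
  have "L \<subseteq> (\<lambda>f. image_graph f H) ` light_embeddings x H n t"
  proof
    fix H' assume "H' \<in> L"
    then have H': "H' \<in> Q" "?w H' \<le> t" by (auto simp: L_def)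
    then obtain f where f: "f \<in> embeddings H n" "H' = image_graph f H"
      using cover_subset_images[OF Q] by blast
    have "x (f ` e) \<le> t" if "e \<in> edges H" for e
    proof -
      have "f ` e \<in> edges H'"
        using f(2) that by (simp add: image_graph_def)
      then have "x (f ` e) \<le> ?w H'"
        using edges_Q[OF H'(1)] fin_edges[OF H'(1)] x by (intro member_le_sum) auto
      with H'(2) show ?thesis by simp
    qed
    with f show "H' \<in> (\<lambda>f. image_graph f H) ` light_embeddings x H n t"
      by (auto simp: light_embeddings_def)
  qed
  then have "card L \<le> card (light_embeddings x H n t)"
    using finite_light_embeddings[OF fin] by (rule surj_card_le[rotated])
  then have "real (card L) \<le> K"
    using K by linarith
  moreover have "card L \<le> card Q"
    using finQ by (intro card_mono) (auto simp: L_def)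
  moreover have "card (Q - L) = card Q - card L"
    using finQ by (intro card_Diff_subset) (auto simp: L_def)
  moreover have "(1 - \<alpha>) * real n / real (num_verts H) \<le> real (card Q)"
    using card_cover_ge[OF Q finQ] H(2) fin
    by (subst pos_divide_le_eq) (auto simp: num_verts_def card_gt_0_iff mult.commute)
  ultimately have "(1 - \<alpha>) * real n / real (num_verts H) - K \<le> real (card (Q - L))"
    by linarith
  then have "((1 - \<alpha>) * real n / real (num_verts H) - K) * t \<le> real (card (Q - L)) * t"
    using t by (rule mult_right_mono)
  also have "\<dots> = (\<Sum>H'\<in>Q - L. t)"
    by simp
  also have "\<dots> \<le> (\<Sum>H'\<in>Q - L. ?w H')"
    by (intro sum_mono) (auto simp: L_def)
  also have "\<dots> \<le> (\<Sum>H'\<in>Q. ?w H')"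
    using finQ w_nonneg by (intro sum_mono2) auto
  finally show ?thesis
    by (simp add: cover_weight_def)
qed

section \<open>The first moment of the number of light embeddings\<close>

context prob_space
begin

lemma light_embedding_event:
  fixes X :: "nat set \<Rightarrow> 'a \<Rightarrow> real"
  assumes G: "finite_simple_graph G"
    and X: "\<And>e. e \<in> edges (complete_graph n) \<Longrightarrow> X e \<in> borel_measurable M"
    and f: "f \<in> embeddings G n"
  shows "{\<omega> \<in> space M. \<forall>e\<in>edges G. X (f ` e) \<omega> \<le> t} \<in> events"
proof (rule sets.sets_Collect_finite_All)
  show "finite (edges G)" by (rule finite_edges[OF G])
next
  fix e assume "e \<in> edges G"
  then have "X (f ` e) \<in> borel_measurable M"
    using embedding_edges(1)[OF G f] X by blast
  then show "{\<omega> \<in> space M. X (f ` e) \<omega> \<le> t} \<in> events"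
    by (simp add: borel_measurable_iff_le)
qed

lemma card_light_embeddings_eq_sum:
  assumes "finite_simple_graph G" "\<omega> \<in> space M"
  shows "real (card (light_embeddings (\<lambda>e. X e \<omega>) G n t)) =
    (\<Sum>f\<in>embeddings G n. indicator {\<omega> \<in> space M. \<forall>e\<in>edges G. X (f ` e) \<omega> \<le> t} \<omega>)"
proof -
  have "finite (embeddings G n)"
    using assms(1) by (simp add: finite_embeddings finite_simple_graph_def)
  moreover have "light_embeddings (\<lambda>e. X e \<omega>) G n t =
      embeddings G n \<inter> {f. \<forall>e\<in>edges G. X (f ` e) \<omega> \<le> t}"
    by (auto simp: light_embeddings_def)
  ultimately show ?thesis
    using assms(2) by (simp add: indicator_def of_bool_def sum.If_cases)
qed

lemma many_light_embeddings_event: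
  assumes G: "finite_simple_graph G"
    and X: "\<And>e. e \<in> edges (complete_graph n) \<Longrightarrow> X e \<in> borel_measurable M"
  shows "{\<omega> \<in> space M. K \<le> real (card (light_embeddings (\<lambda>e. X e \<omega>) G n t))} \<in> events"
proof -
  have "(\<lambda>\<omega>. \<Sum>f\<in>embeddings G n. indicator {\<omega> \<in> space M. \<forall>e\<in>edges G. X (f ` e) \<omega> \<le> t} \<omega> :: real)
      \<in> borel_measurable M"
    using light_embedding_event[OF G X] by (intro borel_measurable_sum borel_measurable_indicator)
  then have [measurable]: "(\<lambda>\<omega>. real (card (light_embeddings (\<lambda>e. X e \<omega>) G n t))) \<in> borel_measurable M"
    using card_light_embeddings_eq_sum[OF G] by (simp cong: measurable_cong)
  show ?thesis
    by measurable
qed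

text \<open>Independence applies to the edges of the image, and injectivity ensures that there are as many of
  them as edges of \<open>G\<close>.\<close>

lemma prob_light_embedding:
  assumes G: "finite_simple_graph G"
    and ind: "indep_vars (\<lambda>_. borel) X (edges (complete_graph n))"
    and exp: "\<And>e. e \<in> edges (complete_graph n) \<Longrightarrow>
      distributed M lborel (X e) (exponential_density 1)"
    and t: "0 \<le> t" and f: "f \<in> embeddings G n"
  shows "prob {\<omega> \<in> space M. \<forall>e\<in>edges G. X (f ` e) \<omega> \<le> t} \<le> t ^ num_edges G"
proof (cases "edges G = {}")
  case True
  then show ?thesis by (simp add: num_edges_def prob_space)
next
  case False
  let ?J = "(\<lambda>e. f ` e) ` edges G"
  have J: "?J \<subseteq> edges (complete_graph n)" "card ?J = num_edges G"
    using embedding_edges[OF G f] by auto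
  have "{\<omega> \<in> space M. \<forall>e\<in>edges G. X (f ` e) \<omega> \<le> t} = (\<Inter>j\<in>?J. X j -` {..t} \<inter> space M)"
    using False by auto
  then have "prob {\<omega> \<in> space M. \<forall>e\<in>edges G. X (f ` e) \<omega> \<le> t} =
      (\<Prod>j\<in>?J. prob (X j -` {..t} \<inter> space M))"
    using False finite_edges[OF G] J(1) by (simp only:) (intro indep_varsD[OF ind], auto)
  also have "\<dots> \<le> (\<Prod>j\<in>?J. t)"
  proof (intro prod_mono conjI)
    fix j assume "j \<in> ?J"
    then have "distributed M lborel (X j) (exponential_density 1)"
      using J(1) exp by blast
    then have "\<P>(\<omega> in M. X j \<omega> \<le> t) = 1 - exp (- t)"
      using exponential_distributedD_le[of "X j" 1 t] t by simp
    moreover have "X j -` {..t} \<inter> space M = {\<omega> \<in> space M. X j \<omega> \<le> t}"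
      by auto
    ultimately show "prob (X j -` {..t} \<inter> space M) \<le> t"
      using exp_ge_add_one_self[of "- t"] by simp
  qed simp
  finally show ?thesis by (simp add: J(2))
qed

lemma prob_many_light_embeddings:
  assumes G: "finite_simple_graph G"
    and ind: "indep_vars (\<lambda>_. borel) X (edges (complete_graph n))"
    and exp: "\<And>e. e \<in> edges (complete_graph n) \<Longrightarrow>
      distributed M lborel (X e) (exponential_density 1)"
    and t: "0 \<le> t" and K: "0 < K"
  shows "prob {\<omega> \<in> space M. K \<le> real (card (light_embeddings (\<lambda>e. X e \<omega>) G n t))}
    \<le> real n ^ num_verts G * t ^ num_edges G / K"
proof -
  have fin: "finite (verts G)"
    using G by (simp add: finite_simple_graph_def)
  have X: "X e \<in> borel_measurable M" if "e \<in> edges (complete_graph n)" for e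
    using distributed_measurable[OF exp[OF that]] by simp
  define A where "A f = {\<omega> \<in> space M. \<forall>e\<in>edges G. X (f ` e) \<omega> \<le> t}" for f
  define Z where "Z \<omega> = (\<Sum>f\<in>embeddings G n. indicator (A f) \<omega> :: real)" for \<omega>
  have A: "A f \<in> events" if "f \<in> embeddings G n" for f
    unfolding A_def by (rule light_embedding_event[OF G X that])
  have Z: "real (card (light_embeddings (\<lambda>e. X e \<omega>) G n t)) = Z \<omega>" if "\<omega> \<in> space M" for \<omega>
    unfolding Z_def A_def by (rule card_light_embeddings_eq_sum[OF G that])
  have int: "integrable M (\<lambda>\<omega>. indicator (A f) \<omega> :: real)" if "f \<in> embeddings G n" for f
    using A[OF that] by (simp add: integrable_real_indicator emeasure_eq_measure)
  have "{\<omega> \<in> space M. K \<le> real (card (light_embeddings (\<lambda>e. X e \<omega>) G n t))} =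
      {\<omega> \<in> space M. K \<le> Z \<omega>}"
    using Z by auto
  then have "prob {\<omega> \<in> space M. K \<le> real (card (light_embeddings (\<lambda>e. X e \<omega>) G n t))}
      \<le> expectation Z / K"
    using K int
    by (simp only:) (intro integral_Markov_inequality_measure[where A = "space M"],
        auto simp: Z_def sum_nonneg)
  also have "expectation Z = (\<Sum>f\<in>embeddings G n. prob (A f))"
    unfolding Z_def using int A by (subst Bochner_Integration.integral_sum) auto
  also have "\<dots> \<le> (\<Sum>f\<in>embeddings G n. t ^ num_edges G)"
    unfolding A_def using prob_light_embedding[OF G ind exp t] by (intro sum_mono) auto
  also have "\<dots> = real (card (embeddings G n)) * t ^ num_edges G"
    by simp
  also have "\<dots> \<le> real n ^ num_verts G * t ^ num_edges G"
    using card_embeddings_le[OF fin, of n] t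
    by (intro mult_right_mono) (auto simp flip: of_nat_power)
  finally show ?thesis
    using K by (simp add: divide_right_mono)
qed

end

section \<open>The choice of the threshold\<close>

lemma no_light_embedding_of_supergraph:
  assumes "subgraph G H" "light_embeddings x G n t = {}"
  shows "light_embeddings x H n t = {}"
proof (rule ccontr)
  assume "light_embeddings x H n t \<noteq> {}"
  then obtain f where f: "f \<in> embeddings H n" "\<And>e. e \<in> edges H \<Longrightarrow> x (f ` e) \<le> t"
    by (auto simp: light_embeddings_def)
  have sub: "verts G \<subseteq> verts H" "edges G \<subseteq> edges H" "edges G \<subseteq> pairs (verts G)"
    using assms(1) by (auto simp: subgraph_def)
  let ?g = "restrict f (verts G)"
  have "?g \<in> embeddings G n"
    using f(1) sub(1) unfolding embeddings_def by (auto simp: inj_on_def PiE_def Pi_def)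
  moreover have "?g ` e = f ` e" if "e \<in> edges G" for e
    using that sub(3) pairs_subset_Pow by (intro image_cong) auto
  ultimately have "?g \<in> light_embeddings x G n t"
    using f(2) sub(2) by (auto simp: light_embeddings_def)
  with assms(2) show False by simp
qed

lemma max_dens_attained:
  assumes H: "finite_simple_graph H" "edges H \<noteq> {}"
  obtains G where "subgraph G H" "finite_simple_graph G" "verts G \<noteq> {}" "0 < num_edges G"
    "max_dens H = real (num_edges G) / real (num_verts G)"
proof -
  let ?S = "{real (num_edges H') / real (num_verts H') | H'. subgraph H' H \<and> verts H' \<noteq> {}}"
  have fin: "finite (verts H)" "finite (edges H)" and E: "edges H \<subseteq> pairs (verts H)"
    using H(1) finite_edges by (auto simp: finite_simple_graph_def)
  have "?S \<subseteq> (\<lambda>(V, E). real (card E) / real (card V)) ` (Pow (verts H) \<times> Pow (edges H))"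
    by (force simp: subgraph_def num_edges_def num_verts_def)
  then have finS: "finite ?S"
    by (rule finite_subset) (use fin in simp)
  have VH: "verts H \<noteq> {}"
    using H(2) E by (auto simp: pairs_def)
  have HS: "real (num_edges H) / real (num_verts H) \<in> ?S"
    using E VH by (auto simp: subgraph_def)
  then have "Max ?S \<in> ?S"
    using finS Max_in by blast
  then obtain G where G: "subgraph G H" "verts G \<noteq> {}"
    "max_dens H = real (num_edges G) / real (num_verts G)"
    by (auto simp: max_dens_def)
  have "0 < real (num_edges H) / real (num_verts H)"
    using VH H(2) fin by (simp add: num_edges_def num_verts_def card_gt_0_iff)
  also have "\<dots> \<le> max_dens H"
    unfolding max_dens_def using finS HS by (rule Max_ge)
  finally have "0 < num_edges G"
    unfolding G(3) using gr0I by fastforce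
  moreover have "finite_simple_graph G"
    using G(1) fin by (auto simp: subgraph_def finite_simple_graph_def intro: finite_subset)
  ultimately show thesis
    using G that by blast
qed

text \<open>The threshold is chosen so that the powers of \<open>n\<close> in the first moment cancel down to \<open>n\<close> to
  the power \<open>v - e / D\<close>, which is \<open>n\<close> for \<open>H\<close> when \<open>D = d\<^sub>H\<close> and \<open>1\<close> for the densest subgraph when
  \<open>D = \<Delta>\<close>.\<close>

lemma first_moment_at_threshold:
  fixes c D :: real
  assumes "0 < n" "0 < e" "0 < c" "c \<le> 1"
  shows "real n ^ v * (c * real n powr (- (1 / D))) ^ e \<le> c * real n powr (real v - real e / D)"
proof -
  have "(real n powr (- (1 / D))) ^ e = real n powr (- (real e / D))"
    using assms(1) by (simp add: powr_power mult.commute)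
  then have "real n ^ v * (c * real n powr (- (1 / D))) ^ e =
      c ^ e * (real n powr real v * real n powr (- (real e / D)))"
    using assms(1) by (simp add: power_mult_distrib powr_realpow)
  also have "\<dots> = c ^ e * real n powr (real v - real e / D)"
    by (simp flip: powr_add)
  also have "c ^ e \<le> c"
    using power_decreasing[of 1 e c] assms by simp
  finally show ?thesis
    by (simp add: mult_right_mono)
qed

lemma (in prob_space) prob_many_light_H:
  assumes H: "finite_simple_graph H" "edges H \<noteq> {}"
    and ind: "indep_vars (\<lambda>_. borel) X (edges (complete_graph n))"
    and exp: "\<And>e. e \<in> edges (complete_graph n) \<Longrightarrow>
      distributed M lborel (X e) (exponential_density 1)"
    and n: "0 < n" and \<kappa>: "0 < \<kappa>" "\<kappa> \<le> 1" and c: "0 < c" "c \<le> 1"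
    and D: "D = max (dens H) (max_dens H)"
    and t: "t = c * real n powr (- (1 / D))"
  shows "prob {\<omega> \<in> space M. \<kappa> * real n \<le> real (card (light_embeddings (\<lambda>e. X e \<omega>) H n t))}
    \<le> c / \<kappa>"
proof -
  have t0: "0 \<le> t"
    using t c by simp
  have Kpos: "0 < \<kappa> * real n"
    using \<kappa> n by simp
  obtain G where G: "subgraph G H" "finite_simple_graph G" "verts G \<noteq> {}" "0 < num_edges G"
    "max_dens H = real (num_edges G) / real (num_verts G)"
    using max_dens_attained[OF H] .
  have vG: "0 < num_verts G"
    using G(2,3) by (simp add: num_verts_def finite_simple_graph_def card_gt_0_iff)
  have Dpos: "0 < D"
    using D G(4,5) vG by (simp add: less_max_iff_disj)
  show ?thesis
  proof (cases "D = dens H")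
    case True
    have eH: "0 < num_edges H"
      using H finite_edges by (simp add: num_edges_def card_gt_0_iff)
    have "real (num_verts H) - real (num_edges H) / D = 1"
      using True Dpos eH by (auto simp: dens_def field_simps)
    then have "real n ^ num_verts H * t ^ num_edges H \<le> c * real n"
      using first_moment_at_threshold[OF n eH c, of "num_verts H" D] n by (simp add: t)
    moreover have "prob {\<omega> \<in> space M. \<kappa> * real n \<le>
          real (card (light_embeddings (\<lambda>e. X e \<omega>) H n t))}
        \<le> real n ^ num_verts H * t ^ num_edges H / (\<kappa> * real n)"
      by (rule prob_many_light_embeddings[OF H(1) ind exp t0 Kpos])
    ultimately have "prob {\<omega> \<in> space M. \<kappa> * real n \<le>
          real (card (light_embeddings (\<lambda>e. X e \<omega>) H n t))} \<le> c * real n / (\<kappa> * real n)"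
      using Kpos by (meson divide_right_mono less_imp_le order_trans)
    then show ?thesis
      using n by simp
  next
    case False
    then have DG: "D = real (num_edges G) / real (num_verts G)"
      using D G(5) by (auto simp: max_def split: if_splits)
    then have "real (num_verts G) - real (num_edges G) / D = 0"
      using G(4) by simp
    then have *: "real n ^ num_verts G * t ^ num_edges G \<le> c"
      using first_moment_at_threshold[OF n G(4) c, of "num_verts G" D] n by (simp add: t)
    have "{\<omega> \<in> space M. \<kappa> * real n \<le> real (card (light_embeddings (\<lambda>e. X e \<omega>) H n t))}
        \<subseteq> {\<omega> \<in> space M. 1 \<le> real (card (light_embeddings (\<lambda>e. X e \<omega>) G n t))}"
    proof safe
      fix \<omega> assume "\<kappa> * real n \<le> real (card (light_embeddings (\<lambda>e. X e \<omega>) H n t))"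
      with Kpos have "light_embeddings (\<lambda>e. X e \<omega>) H n t \<noteq> {}"
        by auto
      then have "light_embeddings (\<lambda>e. X e \<omega>) G n t \<noteq> {}"
        using no_light_embedding_of_supergraph[OF G(1)] by blast
      then have "0 < card (light_embeddings (\<lambda>e. X e \<omega>) G n t)"
        using G(2) by (simp add: card_gt_0_iff finite_light_embeddings finite_simple_graph_def)
      then show "1 \<le> real (card (light_embeddings (\<lambda>e. X e \<omega>) G n t))"
        by linarith
    qed
    moreover have "{\<omega> \<in> space M. 1 \<le> real (card (light_embeddings (\<lambda>e. X e \<omega>) G n t))} \<in> events"
      by (rule many_light_embeddings_event[OF G(2)])
        (use distributed_measurable[OF exp] in simp)
    ultimately have "prob {\<omega> \<in> space M. \<kappa> * real n \<le>
          real (card (light_embeddings (\<lambda>e. X e \<omega>) H n t))}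
        \<le> prob {\<omega> \<in> space M. 1 \<le> real (card (light_embeddings (\<lambda>e. X e \<omega>) G n t))}"
      by (rule finite_measure_mono)
    also have "\<dots> \<le> c"
      using prob_many_light_embeddings[OF G(2) ind exp t0, of 1] * by simp
    also have "c \<le> c / \<kappa>"
      using c \<kappa> by (simp add: field_simps)
    finally show ?thesis .
  qed
qed

section \<open>The lower bound\<close>

theorem theorem3p3:
  fixes H :: "'a graph"
    and M :: "nat \<Rightarrow> 'w measure"
    and X :: "nat \<Rightarrow> nat set \<Rightarrow> 'w \<Rightarrow> real"
    and \<alpha> :: real
  assumes "finite_simple_graph H"
    and "edges H \<noteq> {}"
    and "\<And>n. prob_space (M n)"
    and "\<And>n. prob_space.indep_vars (M n) (\<lambda>_. borel) (X n) (edges (complete_graph n))"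
    and "\<And>n e. e \<in> edges (complete_graph n) \<Longrightarrow>
           distributed (M n) lborel (X n e) (exponential_density 1)"
    and "0 \<le> \<alpha>" and "\<alpha> < 1"
  shows "Omega_P M
           (\<lambda>n \<omega>. min_cover_weight H (\<lambda>e. X n e \<omega>) (\<alpha> * real n) n)
           (\<lambda>n \<omega>. real n powr (1 - 1 / max (dens H) (max_dens H)))"
  unfolding Omega_P_def
proof (intro allI impI)
  fix \<epsilon> :: real assume \<epsilon>: "0 < \<epsilon>"
  define D where "D = max (dens H) (max_dens H)"
  define r where "r = num_verts H"
  \<comment> \<open>A cover has at least \<open>2 * \<kappa> * n\<close> copies, so half of them remain when \<open>\<kappa> * n\<close> are light.\<close>
  define \<kappa> where "\<kappa> = (1 - \<alpha>) / (2 * real r)"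
  \<comment> \<open>The failure probability will be at most \<open>c / \<kappa>\<close>.\<close>
  define c where "c = min 1 (\<epsilon> * \<kappa> / 2)"
  have VH: "verts H \<noteq> {}"
    using assms(1,2) by (auto simp: finite_simple_graph_def pairs_def)
  then have r: "0 < r"
    using assms(1) by (simp add: r_def num_verts_def finite_simple_graph_def card_gt_0_iff)
  have \<kappa>: "0 < \<kappa>" "\<kappa> \<le> 1"
    using r assms(6,7) by (auto simp: \<kappa>_def field_simps)
  have c: "0 < c" "c \<le> 1" "c / \<kappa> < \<epsilon>"
  proof -
    have "c \<le> \<epsilon> * \<kappa> / 2"
      by (simp add: c_def)
    also have "\<dots> < \<epsilon> * \<kappa>"
      using \<epsilon> \<kappa> by simp
    finally show "c / \<kappa> < \<epsilon>"
      using \<kappa> by (simp add: field_simps)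
  qed (use \<epsilon> \<kappa> in \<open>auto simp: c_def\<close>)
  let ?Y = "\<lambda>n \<omega>. min_cover_weight H (\<lambda>e. X n e \<omega>) (\<alpha> * real n) n"
  let ?x = "\<lambda>n. real n powr (1 - 1 / D)"
  \<comment> \<open>For \<open>n \<ge> r\<close> a cover exists, so that the minimum is attained.\<close>
  have bound: "measure (M n) {\<omega> \<in> space (M n). \<bar>?x n\<bar> > 1 / (\<kappa> * c) * \<bar>?Y n \<omega>\<bar>} < \<epsilon>"
    if rn: "r \<le> n" for n
  proof -
    interpret prob_space "M n" by (rule assms(3))
    have n: "0 < n" using r rn by simp
    define t where "t = c * real n powr (- (1 / D))"
    define L where "L = {\<omega> \<in> space (M n).
      \<kappa> * real n \<le> real (card (light_embeddings (\<lambda>e. X n e \<omega>) H n t))}"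
    \<comment> \<open>The weights are nonnegative only almost surely.\<close>
    define N where "N = (\<Union>e\<in>edges (complete_graph n). {\<omega> \<in> space (M n). X n e \<omega> \<le> 0})"
    have meas: "X n e \<in> borel_measurable (M n)" if "e \<in> edges (complete_graph n)" for e
      using distributed_measurable[OF assms(5)[OF that]] by simp
    have "L \<in> events"
      unfolding L_def by (rule many_light_embeddings_event[OF assms(1) meas])
    have "N \<in> null_sets (M n)"
      unfolding N_def
    proof (rule null_sets_UN')
      show "countable (edges (complete_graph n))"
        by (simp add: edges_complete_graph finite_pairs countable_finite)
    next
      fix e assume e: "e \<in> edges (complete_graph n)"
      have "prob {\<omega> \<in> space (M n). X n e \<omega> \<le> 0} = 0"
        using exponential_distributedD_le[OF assms(5)[OF e], of 0] by simp
      then show "{\<omega> \<in> space (M n). X n e \<omega> \<le> 0} \<in> null_sets (M n)"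
        using meas[OF e] by (simp add: null_sets_def emeasure_eq_measure)
    qed
    have "{\<omega> \<in> space (M n). \<bar>?x n\<bar> > 1 / (\<kappa> * c) * \<bar>?Y n \<omega>\<bar>} \<subseteq> L \<union> N"
    proof (rule subsetI, rule ccontr)
      fix \<omega> assume \<omega>: "\<omega> \<in> {\<omega> \<in> space (M n). \<bar>?x n\<bar> > 1 / (\<kappa> * c) * \<bar>?Y n \<omega>\<bar>}" "\<omega> \<notin> L \<union> N"
      have pos: "0 \<le> X n e \<omega>" if "e \<in> edges (complete_graph n)" for e
        using \<omega> that by (force simp: N_def)
      have few: "real (card (light_embeddings (\<lambda>e. X n e \<omega>) H n t)) \<le> \<kappa> * real n"
        using \<omega> by (auto simp: L_def)
      obtain Q where Q: "is_cover (\<alpha> * real n / real n) H n Q"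
        "?Y n \<omega> = cover_weight (\<lambda>e. X n e \<omega>) Q"
        using min_cover_weight_attained[OF assms(1) VH, of n "\<alpha> * real n"] rn assms(6)
        by (auto simp: r_def)
      have "t \<ge> 0"
        using c by (simp add: t_def)
      have cover: "is_cover \<alpha> H n Q"
        using Q(1) n by simp
      have "\<kappa> * c * ?x n = \<kappa> * real n * t"
        using n by (simp add: t_def powr_diff powr_minus field_simps)
      also have "\<dots> = ((1 - \<alpha>) * real n / real (num_verts H) - \<kappa> * real n) * t"
        using r by (simp add: \<kappa>_def r_def field_simps)
      also have "\<dots> \<le> ?Y n \<omega>"
        unfolding Q(2)
        by (rule cover_weight_lower_bound[OF assms(1) VH pos cover few \<open>t \<ge> 0\<close>])
      finally have "\<kappa> * c * ?x n \<le> \<bar>?Y n \<omega>\<bar>"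
        by simp
      then have "?x n \<le> 1 / (\<kappa> * c) * \<bar>?Y n \<omega>\<bar>"
        using \<kappa> c by (simp add: field_simps)
      with \<omega>(1) show False
        by simp
    qed
    then have "prob {\<omega> \<in> space (M n). \<bar>?x n\<bar> > 1 / (\<kappa> * c) * \<bar>?Y n \<omega>\<bar>} \<le> prob (L \<union> N)"
      using \<open>L \<in> events\<close> \<open>N \<in> null_sets (M n)\<close> by (intro finite_measure_mono) auto
    also have "\<dots> = prob L"
      using \<open>L \<in> events\<close> \<open>N \<in> null_sets (M n)\<close> by (simp add: measure_Un_null_set)
    also have "\<dots> \<le> c / \<kappa>"
      unfolding L_def
      by (rule prob_many_light_H[OF assms(1,2,4,5) n \<kappa> c(1,2) D_def t_def])
    also have "\<dots> < \<epsilon>"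
      by (rule c(3))
    finally show ?thesis .
  qed
  show "\<exists>C. eventually (\<lambda>n. measure (M n) {\<omega> \<in> space (M n).
      \<bar>real n powr (1 - 1 / max (dens H) (max_dens H))\<bar> > C * \<bar>?Y n \<omega>\<bar>} < \<epsilon>) sequentially"
    using bound unfolding eventually_sequentially D_def by blast
qed

end
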